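(* For every integer $n\ge 0$, \[ \binom{2n}{n}^3 =[(xyz)^{2n}]\,(1+xy+xz-yz)^{2n}(1+xy-xz+yz)^{2n}(1-xy+xz+yz)^{2n}. \]
   Context: Here $x,y,z$ are indeterminates, and $[(xyz)^{2n}]$ denotes the coefficient of the monomial $x^{2n}y^{2n}z^{2n}$ in the polynomial that follows. *)

theory Defs
  imports "HOL-Library.Poly_Mapping"
begin

datatype indet = Ind_x | Ind_y | Ind_z

text \<open>
  Exponent vectors are finitely supported maps from the indeterminates to the naturals;
  a polynomial maps exponent vectors to their coefficients, with finite support.
  Multiplication on \<open>\<Rightarrow>\<^sub>0\<close> is the convolution product, so this type is the ring
  of integer polynomials in three commuting indeterminates.
\<close>

type_synonym expvec = "indet \<Rightarrow>\<^sub>0 nat"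
type_synonym poly3 = "expvec \<Rightarrow>\<^sub>0 int"

definition var :: "indet \<Rightarrow> poly3" where
  "var v = Poly_Mapping.single (Poly_Mapping.single v 1) 1"

definition exp_xyz :: "nat \<Rightarrow> expvec" where
  "exp_xyz k =
     Poly_Mapping.single Ind_x k + Poly_Mapping.single Ind_y k + Poly_Mapping.single Ind_z k"

lemma var_power: "var v ^ k = Poly_Mapping.single (Poly_Mapping.single v k) 1"
  by (induction k) (simp_all add: var_def mult_single flip: single_add)

lemma power_xyz_eq_single_exp_xyz:
  "(var Ind_x * var Ind_y * var Ind_z) ^ k = Poly_Mapping.single (exp_xyz k) 1"
  by (simp add: power_mult_distrib var_power mult_single exp_xyz_def)

end

theory Submission
  imports Defs
begin

text \<open>Put \<open>a = y * z\<close>, \<open>b = x * z\<close>, \<open>c = x * y\<close> and \<open>La = 1 + b + c - a\<close>, \<open>Lb = 1 + a + c - b\<close>,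
  \<open>Lc = 1 + a + b - c\<close>. The monomial \<open>a ^ i * b ^ j * c ^ k\<close> is \<open>x ^ (j + k) * y ^ (i + k) * z ^ (i + j)\<close>, so
  distinct monomials in \<open>a\<close>, \<open>b\<close>, \<open>c\<close> stay distinct in \<open>x\<close>, \<open>y\<close>, \<open>z\<close>. The identity is the diagonal
  case \<open>i = j = k = n\<close> of a product formula (\<open>coefficient_eq\<close>): the coefficient \<open>C i j k\<close> of
  \<open>a ^ i * b ^ j * c ^ k\<close> in \<open>La ^ (j + k) * Lb ^ (i + k) * Lc ^ (i + j)\<close> is
  \<open>((2 * i) choose i) * ((2 * j) choose j) * ((2 * k) choose k)\<close>.

  With \<open>U = a / (Lb * Lc)\<close>, \<open>V = b / (La * Lc)\<close>, \<open>W = c / (La * Lb)\<close>, the number \<open>C i j k\<close> is the constant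
  term of \<open>1 / (U ^ i * V ^ j * W ^ k)\<close>. In the coordinates \<open>U\<close>, \<open>V\<close>, \<open>W\<close> the volume form
  \<open>da db dc / (a b c)\<close> becomes \<open>dU dV dW / (U V W)\<close> divided by the square root of
  \<open>(1 - 4 * U) * (1 - 4 * V) * (1 - 4 * W)\<close>, which is why the generating function of the \<open>C i j k\<close> is a product
  of three central binomial series. A direct version of this change of variables suffices: the
  constant term of a divergence vanishes, and for the vector field
  \<open>(1 - 4 * U) * U * \<partial>/\<partial>U\<close>, whose divergence is \<open>- 2 * U\<close>, multiplied by
  \<open>1 / (U ^ i * V ^ j * W ^ k)\<close>, this says \<open>i * C i j k = (4 * i - 2) * C (i - 1) j k\<close>. Times
  \<open>Lb * Lc\<close>, the field has polynomial coefficients in \<open>a\<close>, \<open>b\<close>, \<open>c\<close>, so the recurrence comes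
  down to a polynomial identity (\<open>vector_field_identity\<close>), read off at one monomial (\<open>coefficient_Suc\<close>).
  The central binomial coefficients satisfy the same recurrence, and the cyclic symmetry of \<open>C\<close> lowers
  the three indices to \<open>0\<close> one after the other.\<close>

section \<open>Derivations\<close>

text \<open>Additive maps satisfying the Leibniz rule, on a commutative ring with no base ring of constants.\<close>

locale derivation =
  fixes D :: "'a::comm_ring_1 \<Rightarrow> 'a"
  assumes add: "D (f + g) = D f + D g"
    and mult: "D (f * g) = D f * g + f * D g"
begin

lemma zero: "D 0 = 0"
  using add[of 0 0] by simp

lemma one: "D 1 = 0"
  using mult[of 1 1] by simp

lemma minus: "D (- f) = - D f"
  using add[of f "- f"] by (simp add: zero eq_neg_iff_add_eq_0 add.commute)

lemma diff: "D (f - g) = D f - D g"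
  using add[of f "- g"] by (simp add: minus)

lemma eigen_power:
  assumes "D f = h * f"
  shows "D (f ^ m) = of_nat m * h * f ^ m"
  by (induction m) (simp_all add: one mult assms algebra_simps)

lemma eigen_mult:
  assumes "D f = h * f" and "D g = h' * g"
  shows "D (f * g) = (h + h') * (f * g)"
  by (simp add: mult assms algebra_simps)

end

lemma derivation_scale:
  assumes "derivation D"
  shows "derivation (\<lambda>f. c * D f)"
  using assms by (simp add: derivation_def algebra_simps)

lemma derivation_sum:
  assumes "derivation D" and "derivation E"
  shows "derivation (\<lambda>f. D f + E f)"
  using assms by (simp add: derivation_def algebra_simps)

section \<open>Weight derivations\<close>

text \<open>For an additive weight on exponents, the operator that multiplies each monomial by its weight;
  with the weight \<open>e \<mapsto> e v\<close> it is the Euler operator \<open>v \<cdot> \<partial>/\<partial>v\<close>.\<close>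

definition wderiv :: "('e \<Rightarrow> 'r) \<Rightarrow> ('e \<Rightarrow>\<^sub>0 'r) \<Rightarrow> ('e \<Rightarrow>\<^sub>0 'r::comm_ring_1)" where
  "wderiv w = Poly_Mapping.mapp (\<lambda>e c. w e * c)"

lemma lookup_wderiv: "Poly_Mapping.lookup (wderiv w f) e = w e * Poly_Mapping.lookup f e"
  by (simp add: wderiv_def lookup_mapp when_def in_keys_iff)

lemma wderiv_single: "wderiv w (Poly_Mapping.single e c) = Poly_Mapping.single e (w e * c)"
  by (rule poly_mapping_eqI) (simp add: lookup_wderiv lookup_single when_def)

lemma wderiv_add: "wderiv w (f + g) = wderiv w f + wderiv w g"
  by (rule poly_mapping_eqI) (simp add: lookup_wderiv lookup_add algebra_simps)

lemma poly_mapping_single_induct [case_names zero add]: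
  assumes "P 0" and "\<And>f e c. P f \<Longrightarrow> P (Poly_Mapping.single e c + f)"
  shows "P f"
proof (induction f rule: update_induct)
  case const
  show ?case by (fact assms)
next
  case (update f e c)
  have "Poly_Mapping.update e c f = Poly_Mapping.single e c + f"
    using update.hyps
    by (intro poly_mapping_eqI)
       (auto simp: lookup_update lookup_add lookup_single when_def in_keys_iff)
  then show ?case using assms(2) update.IH by simp
qed

lemma derivation_wderiv:
  fixes w :: "'e::comm_monoid_add \<Rightarrow> 'r::comm_ring_1"
  assumes additive: "\<And>d e. w (d + e) = w d + w e"
  shows "derivation (wderiv w)"
proof
  show "wderiv w (f + g) = wderiv w f + wderiv w g" for f g
    by (fact wderiv_add)
  have zero: "wderiv w 0 = 0"
    by (rule poly_mapping_eqI) (simp add: lookup_wderiv)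
  have single: "wderiv w (Poly_Mapping.single d c * g)
      = wderiv w (Poly_Mapping.single d c) * g + Poly_Mapping.single d c * wderiv w g" for d c g
  proof (induction g rule: poly_mapping_single_induct)
    case zero
    show ?case by (simp add: \<open>wderiv w 0 = 0\<close>)
  next
    case (add g e b)
    then show ?case
      by (simp add: distrib_left wderiv_add wderiv_single mult_single additive algebra_simps
          flip: single_add)
  qed
  show "wderiv w (f * g) = wderiv w f * g + f * wderiv w g" for f g
  proof (induction f rule: poly_mapping_single_induct)
    case zero
    show ?case by (simp add: \<open>wderiv w 0 = 0\<close>)
  next
    case (add f e c)
    show ?case
      unfolding distrib_right wderiv_add single add.IH by (simp add: ac_simps)
  qed
qed

section \<open>The vector field\<close>

text \<open>Here \<open>A\<close>, \<open>B\<close>, \<open>C\<close> act as \<open>2 * a * \<partial>/\<partial>a\<close>, \<open>2 * b * \<partial>/\<partial>b\<close>, \<open>2 * c * \<partial>/\<partial>c\<close>. They are doubled because only these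
  doubles act with integer weights on all monomials in \<open>x\<close>, \<open>y\<close>, \<open>z\<close>. The field
  \<open>(p * A + q * B + r * C) / 2\<close> is \<open>Lb * Lc * (1 - 4 * U) * U * \<partial>/\<partial>U\<close>: its coefficients \<open>p\<close>, \<open>q\<close>, \<open>r\<close>
  solve the linear system saying that it annihilates \<open>V\<close> and \<open>W\<close> and multiplies \<open>U\<close> by
  \<open>Lb * Lc - 4 * a\<close>. On the coefficient of
  \<open>a ^ Suc i * b ^ j * c ^ k\<close> the left side and the first three terms on the right agree, which leaves the
  recurrence.\<close>

lemma vector_field_identity:
  fixes a b c :: "'a::comm_ring_1" and i j k :: nat
  defines "La \<equiv> 1 + b + c - a" and "Lb \<equiv> 1 + a + c - b" and "Lc \<equiv> 1 + a + b - c"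
    and "p \<equiv> 1 - a ^ 2 - (b - c) ^ 2" and "q \<equiv> 2 * a * (c - a)" and "r \<equiv> 2 * a * (b - a)"
  assumes A: "derivation A" and B: "derivation B" and C: "derivation C"
    and Aabc: "A a = 2 * a" "A b = 0" "A c = 0"
    and Babc: "B a = 0" "B b = 2 * b" "B c = 0"
    and Cabc: "C a = 0" "C b = 0" "C c = 2 * c"
  defines "F \<equiv> La ^ (j + k) * (Lb ^ (i + k) * Lc ^ (i + j))"
  shows "A (p * F) + B (q * F) + C (r * F)
    = of_nat (2 * Suc i) * (p * F) + of_nat (2 * j) * (q * F) + of_nat (2 * k) * (r * F)
      + of_nat (8 * i + 4) * (a * F) - of_nat (2 * Suc i) * (Lb * Lc * F)"
proof -
  interpret A: derivation A by (fact A)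
  interpret B: derivation B by (fact B)
  interpret C: derivation C by (fact C)
  define D where "D f = p * A f + q * B f + r * C f" for f
  have "derivation D"
    unfolding D_def by (intro derivation_sum derivation_scale A B C)
  then interpret D: derivation D .
  note simps = Aabc Babc Cabc A.add A.diff A.one B.add B.diff B.one C.add C.diff C.one
  \<comment> \<open>The field only multiplies \<open>La\<close>, \<open>Lb\<close>, \<open>Lc\<close> by polynomials, because it does so to \<open>a\<close>, \<open>b\<close>, \<open>c\<close> and
    \<open>U\<close>, \<open>V\<close>, \<open>W\<close> up to denominators; so powers are differentiated without lowering any exponent.\<close>
  define ha hb hc where "ha = 2 * a * (b + c - a - 1)"
    and "hb = 2 * a * (1 - a + b - c)" and "hc = 2 * a * (1 - a + c - b)"
  have "D La = ha * La" "D Lb = hb * Lb" "D Lc = hc * Lc"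
    unfolding D_def La_def Lb_def Lc_def p_def q_def r_def ha_def hb_def hc_def
    by (simp_all add: simps power2_eq_square algebra_simps)
  then have "D F = (of_nat (j + k) * ha + (of_nat (i + k) * hb + of_nat (i + j) * hc)) * F"
    unfolding F_def by (intro D.eigen_mult D.eigen_power)
  moreover have "A (p * F) + B (q * F) + C (r * F) = D F + (A p + B q + C r) * F"
    by (simp add: D_def A.mult B.mult C.mult algebra_simps)
  moreover have "A p + B q + C r = - 4 * a ^ 2"
  proof -
    have two: "A 2 = 0" "B 2 = 0" "C 2 = 0"
      using A.add[of 1 1] B.add[of 1 1] C.add[of 1 1] by (simp_all add: A.one B.one C.one)
    show ?thesis
      unfolding p_def q_def r_def
      by (simp add: simps power2_eq_square A.mult B.mult C.mult two algebra_simps)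
  qed
  ultimately have "A (p * F) + B (q * F) + C (r * F)
    = (of_nat (j + k) * ha + (of_nat (i + k) * hb + of_nat (i + j) * hc) - 4 * a ^ 2) * F"
    by (simp only:) (simp add: algebra_simps)
  also have "of_nat (j + k) * ha + (of_nat (i + k) * hb + of_nat (i + j) * hc) - 4 * a ^ 2
    = of_nat (2 * Suc i) * p + of_nat (2 * j) * q + of_nat (2 * k) * r
      + of_nat (8 * i + 4) * a - of_nat (2 * Suc i) * (Lb * Lc)"
    unfolding La_def Lb_def Lc_def p_def q_def r_def ha_def hb_def hc_def
    by (simp add: power2_eq_square algebra_simps)
  finally show ?thesis
    by (simp add: algebra_simps)
qed

section \<open>The coefficients\<close>

text \<open>The exponent vector of \<open>a ^ i * b ^ j * c ^ k\<close> for \<open>a = v * w\<close>, \<open>b = w * u\<close>, \<open>c = u * v\<close>. The three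
  indeterminates are parameters, so that one recurrence in \<open>i\<close> serves all three indices by rotation.\<close>

definition expo :: "indet \<Rightarrow> indet \<Rightarrow> indet \<Rightarrow> nat \<Rightarrow> nat \<Rightarrow> nat \<Rightarrow> expvec" where
  "expo u v w i j k = Poly_Mapping.single u (j + k) + Poly_Mapping.single v (i + k)
     + Poly_Mapping.single w (i + j)"

text \<open>The factor \<open>La = 1 + b + c - a\<close> belonging to \<open>u\<close>; the other two are its rotations. It is symmetric in
  \<open>v\<close> and \<open>w\<close>.\<close>

definition factor :: "indet \<Rightarrow> indet \<Rightarrow> indet \<Rightarrow> poly3" where
  "factor u v w = 1 + var u * var w + var u * var v - var v * var w"

text \<open>The number \<open>C i j k\<close>: the coefficient of \<open>a ^ i * b ^ j * c ^ k\<close> in \<open>La ^ (j + k) * Lb ^ (i + k) * Lc ^ (i + j)\<close>.\<close>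

definition coefficient :: "indet \<Rightarrow> indet \<Rightarrow> indet \<Rightarrow> nat \<Rightarrow> nat \<Rightarrow> nat \<Rightarrow> int" where
  "coefficient u v w i j k = Poly_Mapping.lookup
     (factor u v w ^ (j + k) * (factor v w u ^ (i + k) * factor w u v ^ (i + j)))
     (expo u v w i j k)"

lemma coefficient_rotate: "coefficient u v w i j k = coefficient v w u j k i"
  unfolding coefficient_def expo_def by (simp add: ac_simps)

lemma lookup_of_nat_mult:
  "Poly_Mapping.lookup (of_nat m * f) e = of_nat m * Poly_Mapping.lookup f e"
  for f :: "'e::comm_monoid_add \<Rightarrow>\<^sub>0 'r::comm_ring_1"
  by (induction m) (simp_all add: lookup_add algebra_simps)

lemma lookup_single_mult:
  "Poly_Mapping.lookup (Poly_Mapping.single d 1 * f) (d + e) = Poly_Mapping.lookup f e"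
  for f :: "'e::cancel_comm_monoid_add \<Rightarrow>\<^sub>0 'r::comm_ring_1"
  by (induction f rule: poly_mapping_single_induct)
     (simp_all add: distrib_left lookup_add mult_single lookup_single when_def)

lemma coefficient_Suc:
  assumes distinct: "distinct [u, v, w]"
  shows "int (Suc i) * coefficient u v w (Suc i) j k
    = int (4 * i + 2) * coefficient u v w i j k"
proof -
  let ?lk = "Poly_Mapping.lookup"
  have neq: "u \<noteq> v" "v \<noteq> u" "u \<noteq> w" "w \<noteq> u" "v \<noteq> w" "w \<noteq> v"
    using distinct by auto
  \<comment> \<open>The weight \<open>wt u v w\<close> counts \<open>a = v * w\<close> twice and \<open>b = w * u\<close>, \<open>c = u * v\<close> not at all.\<close>
  define wt where "wt = (\<lambda>u v w (e :: expvec). int (?lk e v) + int (?lk e w) - int (?lk e u))"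
  have der: "derivation (wderiv (wt u v w))" for u v w
    by (rule derivation_wderiv) (simp add: wt_def lookup_add)
  define a b c where "a = var v * var w" and "b = var w * var u" and "c = var u * var v"
  have mon: "wderiv (wt s t r) (var x * var y)
    = of_int (wt s t r (Poly_Mapping.single x 1) + wt s t r (Poly_Mapping.single y 1))
      * (var x * var y)" for s t r x y
  proof -
    have "wt s t r (d + e) = wt s t r d + wt s t r e" for d e
      by (simp add: wt_def lookup_add)
    then show ?thesis
      by (simp add: var_def mult_single wderiv_single flip: single_of_int)
  qed
  have wt_single: "wt s t r (Poly_Mapping.single x 1)
    = (if x = t then 1 else 0) + (if x = r then 1 else 0) - (if x = s then 1 else 0)" for s t r x
    by (simp add: wt_def lookup_single when_def)
  define La Lb Lc where "La = 1 + b + c - a" and "Lb = 1 + a + c - b" and "Lc = 1 + a + b - c"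
  have L: "factor u v w = La" "factor v w u = Lb" "factor w u v = Lc"
    unfolding factor_def La_def Lb_def Lc_def a_def b_def c_def by (simp_all add: ac_simps)
  define F where "F = La ^ (j + k) * (Lb ^ (i + k) * Lc ^ (i + j))"
  define p q r where "p = 1 - a ^ 2 - (b - c) ^ 2" and "q = 2 * a * (c - a)"
    and "r = 2 * a * (b - a)"
  define e where "e = expo u v w (Suc i) j k"
  have "wderiv (wt u v w) (p * F) + wderiv (wt v w u) (q * F) + wderiv (wt w u v) (r * F)
    = of_nat (2 * Suc i) * (p * F) + of_nat (2 * j) * (q * F) + of_nat (2 * k) * (r * F)
      + of_nat (8 * i + 4) * (a * F) - of_nat (2 * Suc i) * (Lb * Lc * F)"
    unfolding p_def q_def r_def F_def La_def Lb_def Lc_def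
    by (rule vector_field_identity; (rule der)?)
       (simp_all add: neq a_def b_def c_def mon wt_single del: One_nat_def)
  then have "?lk (wderiv (wt u v w) (p * F) + wderiv (wt v w u) (q * F)
      + wderiv (wt w u v) (r * F)) e
    = ?lk (of_nat (2 * Suc i) * (p * F) + of_nat (2 * j) * (q * F) + of_nat (2 * k) * (r * F)
      + of_nat (8 * i + 4) * (a * F) - of_nat (2 * Suc i) * (Lb * Lc * F)) e"
    by (rule arg_cong)
  moreover have "wt u v w e = int (2 * Suc i)" "wt v w u e = int (2 * j)"
    "wt w u v e = int (2 * k)"
    using distinct by (auto simp: wt_def e_def expo_def lookup_add lookup_single when_def)
  ultimately have "int (2 * Suc i) * ?lk (Lb * Lc * F) e = int (8 * i + 4) * ?lk (a * F) e"
    by (simp only: lookup_add lookup_minus lookup_wderiv lookup_of_nat_mult)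
  moreover have "?lk (Lb * Lc * F) e = coefficient u v w (Suc i) j k"
    unfolding coefficient_def L F_def e_def by (simp add: ac_simps)
  \<comment> \<open>Lowering \<open>i\<close> by one takes the factor \<open>Lb * Lc\<close> off the product and \<open>a\<close> off the monomial.\<close>
  moreover have "?lk (a * F) e = coefficient u v w i j k"
  proof -
    define d :: expvec where "d = Poly_Mapping.single v 1 + Poly_Mapping.single w 1"
    have "a = Poly_Mapping.single d 1"
      by (simp add: a_def d_def var_def mult_single)
    moreover have "e = d + expo u v w i j k"
      by (simp add: e_def d_def expo_def single_add ac_simps flip: One_nat_def plus_1_eq_Suc)
    ultimately show ?thesis
      by (simp add: lookup_single_mult coefficient_def L F_def)
  qed
  ultimately show ?thesis
    by (simp add: algebra_simps)
qed

lemma central_binomial_Suc: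
  "Suc i * ((2 * Suc i) choose Suc i) = (4 * i + 2) * ((2 * i) choose i)"
proof -
  have "Suc i * ((2 * Suc i) choose Suc i) = Suc (Suc (2 * i)) * (Suc (2 * i) choose i)"
    unfolding Suc_times_binomial_eq by (subst mult.commute) (simp only: mult_Suc_right add_2_eq_Suc)
  then have 1: "Suc i * ((2 * Suc i) choose Suc i) = 2 * (Suc i * (Suc (2 * i) choose i))"
    by (simp del: binomial_Suc_Suc)
  have "Suc i * (Suc (2 * i) choose i) = Suc i * (Suc (2 * i) choose Suc i)"
    using binomial_symmetric[of i "Suc (2 * i)"] by (simp add: Suc_diff_le)
  also have "\<dots> = Suc (2 * i) * ((2 * i) choose i)"
    using Suc_times_binomial_eq[of "2 * i" i] by (simp only: mult.commute)
  finally show ?thesis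
    using 1 by (simp del: binomial_Suc_Suc mult_Suc)
qed

lemma coefficient_eq_central_binomial_mult:
  assumes "distinct [u, v, w]"
  shows "coefficient u v w i j k = int ((2 * i) choose i) * coefficient u v w 0 j k"
proof (induction i)
  case 0
  show ?case by simp
next
  case (Suc i)
  have "int (Suc i) * coefficient u v w (Suc i) j k
    = int (4 * i + 2) * int ((2 * i) choose i) * coefficient u v w 0 j k"
    using coefficient_Suc[OF assms, of i j k] Suc.IH by simp
  also have "\<dots> = int (Suc i) * (int ((2 * Suc i) choose Suc i) * coefficient u v w 0 j k)"
    unfolding of_nat_mult[symmetric] central_binomial_Suc[symmetric] by (simp only: of_nat_mult mult.assoc)
  finally show ?case
    by (metis mult_cancel_left of_nat_eq_0_iff nat.distinct(1))
qed

lemma coefficient_eq: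
  assumes "distinct [u, v, w]"
  shows "coefficient u v w i j k
    = int ((2 * i) choose i) * int ((2 * j) choose j) * int ((2 * k) choose k)"
proof -
  have d: "distinct [v, w, u]" "distinct [w, u, v]"
    using assms by auto
  have "coefficient u v w i j k = int ((2 * i) choose i) * coefficient v w u j k 0"
    using coefficient_eq_central_binomial_mult[OF assms] coefficient_rotate by metis
  also have "coefficient v w u j k 0 = int ((2 * j) choose j) * coefficient w u v k 0 0"
    using coefficient_eq_central_binomial_mult[OF d(1)] coefficient_rotate by metis
  also have "coefficient w u v k 0 0 = int ((2 * k) choose k) * coefficient w u v 0 0 0"
    by (rule coefficient_eq_central_binomial_mult[OF d(2)])
  also have "coefficient w u v 0 0 0 = 1"
    by (simp add: coefficient_def expo_def lookup_one)
  finally show ?thesis by simp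
qed

theorem theorem5p4:
  fixes n :: nat
  shows "let x = var Ind_x; y = var Ind_y; z = var Ind_z in
    int (((2 * n) choose n) ^ 3) =
      Poly_Mapping.lookup
        ((1 + x * y + x * z - y * z) ^ (2 * n) *
         (1 + x * y - x * z + y * z) ^ (2 * n) *
         (1 - x * y + x * z + y * z) ^ (2 * n))
        (exp_xyz (2 * n))"
proof -
  define x y z where "x = var Ind_x" and "y = var Ind_y" and "z = var Ind_z"
  have "factor Ind_x Ind_y Ind_z = 1 + x * y + x * z - y * z"
    "factor Ind_y Ind_z Ind_x = 1 + x * y - x * z + y * z"
    "factor Ind_z Ind_x Ind_y = 1 - x * y + x * z + y * z"
    by (simp_all add: factor_def x_def y_def z_def algebra_simps)
  moreover have "expo Ind_x Ind_y Ind_z n n n = exp_xyz (2 * n)"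
    by (simp add: expo_def exp_xyz_def mult_2)
  ultimately have "coefficient Ind_x Ind_y Ind_z n n n = Poly_Mapping.lookup
        ((1 + x * y + x * z - y * z) ^ (2 * n) *
         (1 + x * y - x * z + y * z) ^ (2 * n) *
         (1 - x * y + x * z + y * z) ^ (2 * n))
        (exp_xyz (2 * n))"
    unfolding coefficient_def by (simp only: mult_2 mult.assoc)
  then show ?thesis
    unfolding Let_def x_def y_def z_def
    using coefficient_eq[of Ind_x Ind_y Ind_z n n n] by (simp add: power3_eq_cube)
qed

end
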